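(* Let $Y_\infty=(Y_i)_{i\in\mathbb{Z}}$ be a stationary $\beta$-mixing process with values in $\mathbb{R}^p$ and mixing coefficients $\beta_a$, $a>0$. Let $\mathcal{F}$ be a class of prediction functions with fixed memory length $d<n$, and suppose there is $M<\infty$ such that $Q_k(f):=\sqrt{\mathbb{E}[\ell(Y_{k+1}-f(Y_{1:k}))^2]}\le M$ for all $f\in\mathcal{F}$ and all $k\in\mathbb{N}$ (for which $f(Y_{1:k})$ is defined). Suppose the sample $Y_{1:n}$ is observed, and let $\mu$ and $a>d$ be integers such that $2\mu a+d=n$. Then for any $f\in\mathcal{F}$ and all $\eta>2\mu\beta_{a-d}$, the following bound holds with probability at least $1-\eta$: $$R_n(f)\le\widehat{R}_n(f)+Me^2\sqrt{\frac{\mathcal{E}(4-\log\mathcal{E})}{2}},$$ where $$\mathcal{E}=\frac{4\log G(n,\mathcal{C}_{\ell\circ\mathcal{F}})+4\log(8/\eta')}{\mu},\qquad \eta'=\eta-2\mu\beta_{a-d}.$$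
   Context: Notation: $Y_{i:j}=(Y_i,\dots,Y_j)$. Stationary means strictly stationary. For a stationary sequence with law $\mathbb{P}_\infty$, let $\mathbb{P}_0$, $\mathbb{P}_a$, $\mathbb{P}_{0\otimes a}$ be the restrictions of $\mathbb{P}_\infty$ to $\sigma(Y_{-\infty:0})$, $\sigma(Y_{a:\infty})$, $\sigma(Y_{-\infty:0},Y_{a:\infty})$; the $\beta$-mixing coefficient is $\beta_a=\|\mathbb{P}_0\times\mathbb{P}_a-\mathbb{P}_{0\otimes a}\|_{TV}$ (total variation distance, supremum over events of the absolute difference), and the process is $\beta$-mixing if $\beta_a\to0$ as $a\to\infty$. Probabilities are under the joint law of $Y_{1:n+1}$. Loss: $\ell:\mathbb{R}^p\to[0,\infty)$ with $\ell(0)=0$, applied to the difference between observation and prediction. Fixed memory of length $d$: a prediction function $f$ uses only the most recent $d$ observations, i.e. $f(Y_{1:i})=f(Y_{i-d+1:i})$, so $f$ is determined by a map $\mathbb{R}^{d\times p}\to\mathbb{R}^p$. Risk: $R_n(f)=\mathbb{E}[\ell(Y_{n+1}-f(Y_{1:n}))]$. Training error: $\widehat{R}_n(f)=\frac{1}{n-d}\sum_{i=d+1}^n\ell(Y_i-f(Y_{1:i-1}))$. Growth function: for a collection $\mathcal{C}$ of subsets of a set $\mathbb{U}$, $G(n,\mathcal{C})=\sup_{S\subset\mathbb{U},|S|=n}|\{S\cap C:C\in\mathcal{C}\}|$. For a class $\mathcal F$ of functions $f:\mathbb{U}\to\mathbb{R}^p$ (here $\mathbb{U}=\mathbb{R}^{d\times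 p}$), $C_{\ell\circ f}=\{(u,u_0,u_0')\in\mathbb{U}\times\mathbb{R}^p\times\mathbb{R}:\ell(u_0-f(u))-u_0'\ge0\}$ and $\mathcal{C}_{\ell\circ\mathcal{F}}=\{C_{\ell\circ f}:f\in\mathcal{F}\}$.
   Formalization: The formal statement, for each fixed f, additionally assumes 𝓔 ≤ e⁴ − 1/20: for 𝓔 > e⁴ the square root is undefined, and at or just below e⁴ the deviation term vanishes and the claim is false (e.g. i.i.d. fair coin flips with 0-1 loss and F = {0}). *)

theory Defs
  imports "HOL-Probability.Probability"
begin

definition stationary :: "'w measure \<Rightarrow> (int \<Rightarrow> 'w \<Rightarrow> 'b::topological_space) \<Rightarrow> bool" where
  "stationary P Y \<longleftrightarrow>
     (\<forall>k. distr P (\<Pi>\<^sub>M i\<in>UNIV. borel) (\<lambda>\<omega> i. Y (i + k) \<omega>)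
        = distr P (\<Pi>\<^sub>M i\<in>UNIV. borel) (\<lambda>\<omega> i. Y i \<omega>))"

definition law_on ::
  "'w measure \<Rightarrow> (int \<Rightarrow> 'w \<Rightarrow> 'b::topological_space) \<Rightarrow> int set \<Rightarrow> (int \<Rightarrow> 'b) measure" where
  "law_on P Y I = distr P (\<Pi>\<^sub>M i\<in>I. borel) (\<lambda>\<omega>. \<lambda>i\<in>I. Y i \<omega>)"

definition joint_law_on ::
  "'w measure \<Rightarrow> (int \<Rightarrow> 'w \<Rightarrow> 'b::topological_space) \<Rightarrow> int set \<Rightarrow> int set
     \<Rightarrow> ((int \<Rightarrow> 'b) \<times> (int \<Rightarrow> 'b)) measure" where
  "joint_law_on P Y I J =
     distr P ((\<Pi>\<^sub>M i\<in>I. borel) \<Otimes>\<^sub>M (\<Pi>\<^sub>M i\<in>J. borel))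
       (\<lambda>\<omega>. (\<lambda>i\<in>I. Y i \<omega>, \<lambda>i\<in>J. Y i \<omega>))"

text \<open>Total variation distance of two finite measures on the same sigma-algebra, as the supremum
  of the absolute difference over all events (no factor 2).\<close>

definition tv_dist :: "'a measure \<Rightarrow> 'a measure \<Rightarrow> real" where
  "tv_dist \<mu> \<nu> = (SUP A\<in>sets \<mu>. \<bar>measure \<mu> A - measure \<nu> A\<bar>)"

text \<open>Only \<open>a > 0\<close> is meant: then the index sets of past and future are disjoint, and the
  sigma-algebra generated by both is identified with the product sigma-algebra.\<close>

definition beta_coeff :: "'w measure \<Rightarrow> (int \<Rightarrow> 'w \<Rightarrow> 'b::topological_space) \<Rightarrow> nat \<Rightarrow> real" where
  "beta_coeff P Y a =
     tv_dist (law_on P Y {..0} \<Otimes>\<^sub>M law_on P Y {int a..}) (joint_law_on P Y {..0} {int a..})"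

definition beta_mixing :: "'w measure \<Rightarrow> (int \<Rightarrow> 'w \<Rightarrow> 'b::topological_space) \<Rightarrow> bool" where
  "beta_mixing P Y \<longleftrightarrow> beta_coeff P Y \<longlonglongrightarrow> 0"

text \<open>The space of windows of \<open>d\<close> consecutive observations is the product measurable space over
  \<open>{..<d}\<close>; its points are extensional functions. Position \<open>0\<close> holds the oldest observation.
  A predictor with memory \<open>d\<close> is a measurable map on this space.\<close>

abbreviation window_space :: "nat \<Rightarrow> (nat \<Rightarrow> 'b::topological_space) measure" where
  "window_space d \<equiv> (\<Pi>\<^sub>M j\<in>{..<d}. borel)"

definition window :: "(int \<Rightarrow> 'w \<Rightarrow> 'b) \<Rightarrow> nat \<Rightarrow> nat \<Rightarrow> 'w \<Rightarrow> nat \<Rightarrow> 'b" where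
  "window Y d k \<omega> = (\<lambda>j\<in>{..<d}. Y (int k - int d + 1 + int j) \<omega>)"

text \<open>The loss of predicting observation \<open>k + 1\<close> from observations \<open>1, \<dots>, k\<close>, where \<open>k \<ge> d\<close>.\<close>

definition pred_loss ::
  "(int \<Rightarrow> 'w \<Rightarrow> 'b::ab_group_add) \<Rightarrow> ('b \<Rightarrow> real) \<Rightarrow> nat \<Rightarrow> ((nat \<Rightarrow> 'b) \<Rightarrow> 'b) \<Rightarrow> nat \<Rightarrow> 'w \<Rightarrow> real" where
  "pred_loss Y loss d f k \<omega> = loss (Y (int k + 1) \<omega> - f (window Y d k \<omega>))"

definition risk ::
  "'w measure \<Rightarrow> (int \<Rightarrow> 'w \<Rightarrow> 'b::ab_group_add) \<Rightarrow> ('b \<Rightarrow> real) \<Rightarrow> nat \<Rightarrow> ((nat \<Rightarrow> 'b) \<Rightarrow> 'b) \<Rightarrow> nat \<Rightarrow> real" where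
  "risk P Y loss d f n = (\<integral>\<omega>. pred_loss Y loss d f n \<omega> \<partial>P)"

definition training_error ::
  "(int \<Rightarrow> 'w \<Rightarrow> 'b::ab_group_add) \<Rightarrow> ('b \<Rightarrow> real) \<Rightarrow> nat \<Rightarrow> ((nat \<Rightarrow> 'b) \<Rightarrow> 'b) \<Rightarrow> nat \<Rightarrow> 'w \<Rightarrow> real" where
  "training_error Y loss d f n \<omega> =
     1 / (real n - real d) * (\<Sum>i = d+1..n. pred_loss Y loss d f (i - 1) \<omega>)"

definition Q_loss ::
  "'w measure \<Rightarrow> (int \<Rightarrow> 'w \<Rightarrow> 'b::ab_group_add) \<Rightarrow> ('b \<Rightarrow> real) \<Rightarrow> nat \<Rightarrow> ((nat \<Rightarrow> 'b) \<Rightarrow> 'b) \<Rightarrow> nat \<Rightarrow> real" where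
  "Q_loss P Y loss d f k = sqrt (\<integral>\<omega>. (pred_loss Y loss d f k \<omega>)\<^sup>2 \<partial>P)"

text \<open>The supremum is over a set of naturals bounded by \<open>2 ^ n\<close>; the condition \<open>finite S\<close>
  matters only for \<open>n = 0\<close>.\<close>

definition growth_function :: "'u set \<Rightarrow> nat \<Rightarrow> 'u set set \<Rightarrow> nat" where
  "growth_function U n \<C> =
     (SUP S\<in>{S. S \<subseteq> U \<and> finite S \<and> card S = n}. card ((\<lambda>C. S \<inter> C) ` \<C>))"

definition loss_universe :: "nat \<Rightarrow> ((nat \<Rightarrow> 'b::topological_space) \<times> 'b \<times> real) set" where
  "loss_universe d = space (window_space d) \<times> UNIV \<times> UNIV"

definition loss_set ::
  "('b \<Rightarrow> real) \<Rightarrow> nat \<Rightarrow> ((nat \<Rightarrow> 'b) \<Rightarrow> 'b) \<Rightarrow> ((nat \<Rightarrow> 'b::{topological_space,ab_group_add}) \<times> 'b \<times> real) set" where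
  "loss_set loss d f = {(u, u0, u0') \<in> loss_universe d. loss (u0 - f u) - u0' \<ge> 0}"

end

theory Submission
  imports Defs
begin

text \<open>
  The claim concerns one fixed predictor \<open>f\<close>, so it is a one-sided deviation inequality for the
  average of the dependent, identically distributed, nonnegative losses \<open>X\<^sub>t\<close>: with high probability
  their average does not fall short of the mean \<open>R\<close> by more than \<open>t\<close>, where \<open>t\<close> is the
  confidence radius. Write \<open>\<beta>\<close> for the mixing coefficient at distance \<open>a - d\<close>.

  For independent losses a second moment bound suffices. If \<open>Z \<ge> 0\<close> and \<open>E Z\<^sup>2 \<le> M\<^sup>2\<close>,
  then \<open>exp (- x) \<le> 1 - x + x\<^sup>2 / 2\<close> for \<open>x \<ge> 0\<close> gives
  \<open>E (exp (- \<theta> Z)) \<le> exp (- \<theta> E Z + \<theta>\<^sup>2 M\<^sup>2 / 2)\<close>, so the lower tail of a mean of \<open>\<mu>\<close>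
  independent copies is at most \<open>exp (- \<mu> t\<^sup>2 / (2 M\<^sup>2))\<close> (\<open>laplace_transform_nonneg_bound\<close>).

  Dependence is handled by blocking. The \<open>2 \<mu> a\<close> training losses are cut into \<open>2 \<mu>\<close>
  consecutive blocks of length \<open>a\<close>. Their block averages inherit mean \<open>R\<close> and second moment at most
  \<open>M\<^sup>2\<close>. A block of losses reads \<open>a + d\<close> observations, so two blocks of equal parity are separated
  by at least \<open>a - d\<close> time steps, and replacing the joint law of past and future by the product law
  costs at most \<open>\<beta>\<close> in the probability of any event. The exchange has to be made for events
  rather than for the exponential moment, since in the Chernoff bound an error of size \<open>\<beta>\<close> in the
  moment would be multiplied by a large exponential. The induction in \<open>lower_tail_sum_gaps\<close>
  therefore carries a tail bound \<open>L ^ m * exp (\<theta> * s) + m * \<beta>\<close> for all levels \<open>s\<close> at once: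
  integrating it over an independent next summand reproduces it with one more factor \<open>L\<close>, and the
  exchange of laws adds one \<open>\<beta>\<close>. If the training error is below \<open>R - t\<close>, then so is the average
  over the even or over the odd blocks, whence the failure probability is at most
  \<open>2 exp (- \<mu> t\<^sup>2 / (2 M\<^sup>2)) + 2 \<mu> \<beta>\<close> (\<open>risk_minus_training_error_tail\<close>).

  It remains to compare the radius with \<open>\<E>\<close> (\<open>radius_dichotomy\<close>). Here
  \<open>t\<^sup>2 = M\<^sup>2 exp 4 \<E> (4 - ln \<E>) / 2\<close>. Unless \<open>\<E>\<close> is within \<open>1\<close> of \<open>exp 4\<close>, the factor
  \<open>exp 4 (4 - ln \<E>)\<close> is at least \<open>1\<close>, so the exponent is at least
  \<open>\<mu> \<E> / 4 \<ge> ln (8 / \<eta>')\<close>, as the logarithm of the growth function is nonnegative. Near \<open>exp 4\<close>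
  the radius is at least \<open>M \<ge> R\<close>, and the bound holds surely because the training error is
  nonnegative.
\<close>

section \<open>Functionals of a path\<close>

abbreviation path_space :: "(int \<Rightarrow> 'b::topological_space) measure" where
  "path_space \<equiv> (\<Pi>\<^sub>M i\<in>UNIV. borel)"

text \<open>Restriction sets the coordinates outside \<open>I\<close> to a default value, so the condition says that
  \<open>u\<close> reads its argument on \<open>I\<close> only. Keeping \<open>u\<close> defined on full paths lets functionals with
  different index sets be added and shifted in time without changing type.\<close>

definition determined_on :: "int set \<Rightarrow> ((int \<Rightarrow> 'b) \<Rightarrow> 'c) \<Rightarrow> bool" where
  "determined_on I u \<longleftrightarrow> (\<forall>x. u (restrict x I) = u x)"

lemma determined_onD: "determined_on I u \<Longrightarrow> u (restrict x I) = u x"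
  by (simp add: determined_on_def)

lemma determined_on_mono:
  fixes u :: "(int \<Rightarrow> 'a) \<Rightarrow> 'c"
  assumes "determined_on I u" "I \<subseteq> J"
  shows "determined_on J u"
  unfolding determined_on_def
proof
  fix x :: "int \<Rightarrow> 'a"
  have "restrict (restrict x J) I = restrict x I"
    using assms(2) by (auto simp: restrict_def fun_eq_iff)
  then show "u (restrict x J) = u x"
    using assms(1) by (metis determined_onD)
qed

lemma determined_on_sum:
  assumes "\<And>l. l \<in> A \<Longrightarrow> determined_on I (u l)"
  shows "determined_on I (\<lambda>x. \<Sum>l\<in>A. u l x)"
  using assms by (simp add: determined_on_def)

text \<open>An element of the product over \<open>I\<close> is extensional, hence already a full path that is constant
  off \<open>I\<close>; this transfers measurability on path space to the products over past and future that
  occur in the mixing coefficient.\<close>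

lemma measurable_restricted_path_space:
  assumes "u \<in> measurable path_space N"
  shows "u \<in> measurable (\<Pi>\<^sub>M i\<in>I. borel) N"
proof -
  have "(\<lambda>x. x) \<in> measurable (\<Pi>\<^sub>M i\<in>I. borel) (path_space :: (int \<Rightarrow> 'a) measure)"
  proof (rule measurable_PiM_single')
    fix i :: int
    show "(\<lambda>x. x i) \<in> measurable (\<Pi>\<^sub>M i\<in>I. borel) (borel :: 'a measure)"
    proof (cases "i \<in> I")
      case False
      have "(\<lambda>x. x i) \<in> measurable (\<Pi>\<^sub>M i\<in>I. borel) (borel :: 'a measure) \<longleftrightarrow>
        (\<lambda>x. undefined) \<in> measurable (\<Pi>\<^sub>M i\<in>I. borel :: 'a measure) (borel :: 'a measure)"
        using False by (intro measurable_cong) (auto simp: space_PiM PiE_def extensional_def)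
      then show ?thesis by simp
    qed simp
  qed (auto simp: space_PiM)
  from measurable_compose[OF this assms] show ?thesis .
qed

lemma measurable_path:
  assumes "\<And>i. Y i \<in> borel_measurable P"
  shows "(\<lambda>\<omega>. \<lambda>i\<in>I. Y i \<omega>) \<in> measurable P (\<Pi>\<^sub>M i\<in>I. borel)"
  by (rule measurable_restrict) (rule assms)

lemma measurable_full_path:
  assumes "\<And>i. Y i \<in> borel_measurable P"
  shows "(\<lambda>\<omega> i. Y i \<omega>) \<in> measurable P path_space"
  using measurable_path[where Y=Y and P=P and I=UNIV, OF assms] by (simp only: restrict_UNIV)

lemma measurable_restrict_path:
  "(\<lambda>x. restrict x I) \<in> measurable path_space (\<Pi>\<^sub>M i\<in>I. borel)"
  by (rule measurable_restrict) simp

section \<open>Stationarity and the mixing coefficient\<close>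

lemma law_on_shift:
  fixes Y :: "int \<Rightarrow> 'w \<Rightarrow> 'b::topological_space"
  assumes Y: "\<And>i. Y i \<in> borel_measurable P" and st: "stationary P Y"
  shows "law_on P (\<lambda>i. Y (i + k)) I = law_on P Y I"
proof -
  have "law_on P Z I = distr (distr P path_space (\<lambda>\<omega> i. Z i \<omega>)) (\<Pi>\<^sub>M i\<in>I. borel) (\<lambda>x. restrict x I)"
    if "\<And>i. Z i \<in> borel_measurable P" for Z :: "int \<Rightarrow> 'w \<Rightarrow> 'b"
    unfolding law_on_def
    by (subst distr_distr[OF measurable_restrict_path measurable_full_path[OF that]]) (simp add: comp_def)
  from this[of "\<lambda>i. Y (i + k)"] this[of Y] show ?thesis
    using Y st by (simp add: stationary_def)
qed

lemma joint_law_on_shift: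
  fixes Y :: "int \<Rightarrow> 'w \<Rightarrow> 'b::topological_space"
  assumes Y: "\<And>i. Y i \<in> borel_measurable P" and st: "stationary P Y"
  shows "joint_law_on P (\<lambda>i. Y (i + k)) I J = joint_law_on P Y I J"
proof -
  have "joint_law_on P Z I J = distr (distr P path_space (\<lambda>\<omega> i. Z i \<omega>))
      ((\<Pi>\<^sub>M i\<in>I. borel) \<Otimes>\<^sub>M (\<Pi>\<^sub>M i\<in>J. borel)) (\<lambda>x. (restrict x I, restrict x J))"
    if "\<And>i. Z i \<in> borel_measurable P" for Z :: "int \<Rightarrow> 'w \<Rightarrow> 'b"
    unfolding joint_law_on_def
    by (subst distr_distr[OF measurable_Pair[OF measurable_restrict_path measurable_restrict_path]
          measurable_full_path[OF that]]) (simp add: comp_def)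
  from this[of "\<lambda>i. Y (i + k)"] this[of Y] show ?thesis
    using Y st by (simp add: stationary_def)
qed

text \<open>The mixing coefficient is defined at the time origin; invariance under shifts makes it available
  at every other time.\<close>

lemma beta_coeff_shift:
  assumes "\<And>i. Y i \<in> borel_measurable P" and "stationary P Y"
  shows "beta_coeff P (\<lambda>i. Y (i + k)) b = beta_coeff P Y b"
  unfolding beta_coeff_def by (simp add: law_on_shift[OF assms] joint_law_on_shift[OF assms])

lemma prob_space_law_on:
  assumes "prob_space P" "\<And>i. Y i \<in> borel_measurable P"
  shows "prob_space (law_on P Y I)"
  unfolding law_on_def by (rule prob_space.prob_space_distr[OF assms(1) measurable_path[OF assms(2)]])

lemma sets_law_on [simp]: "sets (law_on P Y I) = sets (\<Pi>\<^sub>M i\<in>I. borel)"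
  by (simp add: law_on_def)

lemma space_law_on [simp]: "space (law_on P Y I) = space (\<Pi>\<^sub>M i\<in>I. borel)"
  by (simp add: law_on_def)

lemma prob_space_joint_law_on:
  assumes "prob_space P" "\<And>i. Y i \<in> borel_measurable P"
  shows "prob_space (joint_law_on P Y I J)"
  unfolding joint_law_on_def
  by (rule prob_space.prob_space_distr[OF assms(1) measurable_Pair[OF measurable_path measurable_path]])
     (rule assms(2))+

lemma tv_dist_upper:
  assumes "prob_space M" "prob_space N" "A \<in> sets M"
  shows "\<bar>measure M A - measure N A\<bar> \<le> tv_dist M N"
  unfolding tv_dist_def
proof (rule cSUP_upper[OF assms(3)])
  have "\<bar>measure M B - measure N B\<bar> \<le> 1" for B
    using prob_space.prob_le_1[OF assms(1), of B] prob_space.prob_le_1[OF assms(2), of B]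
      measure_nonneg[of M B] measure_nonneg[of N B] by linarith
  then show "bdd_above ((\<lambda>A. \<bar>measure M A - measure N A\<bar>) ` sets M)"
    by (intro bdd_aboveI2[where M=1]) simp
qed

lemma beta_coeff_upper:
  assumes P: "prob_space P" and Y: "\<And>i. Y i \<in> borel_measurable P"
    and A: "A \<in> sets ((\<Pi>\<^sub>M i\<in>{..0}. borel) \<Otimes>\<^sub>M (\<Pi>\<^sub>M i\<in>{int b..}. borel))"
  shows "\<bar>measure (law_on P Y {..0} \<Otimes>\<^sub>M law_on P Y {int b..}) A
    - measure (joint_law_on P Y {..0} {int b..}) A\<bar> \<le> beta_coeff P Y b"
  unfolding beta_coeff_def
proof (rule tv_dist_upper)
  interpret L1: prob_space "law_on P Y {..0}" by (rule prob_space_law_on[OF P Y])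
  interpret L2: prob_space "law_on P Y {int b..}" by (rule prob_space_law_on[OF P Y])
  interpret pair_prob_space "law_on P Y {..0}" "law_on P Y {int b..}" ..
  show "prob_space (law_on P Y {..0} \<Otimes>\<^sub>M law_on P Y {int b..})"
    by (rule P.prob_space_axioms)
  show "prob_space (joint_law_on P Y {..0} {int b..})" by (rule prob_space_joint_law_on[OF P Y])
  show "A \<in> sets (law_on P Y {..0} \<Otimes>\<^sub>M law_on P Y {int b..})"
    using A by (simp cong: sets_pair_measure_cong)
qed

lemma beta_coeff_nonneg:
  assumes "prob_space P" "\<And>i. Y i \<in> borel_measurable P"
  shows "beta_coeff P Y b \<ge> 0"
  using beta_coeff_upper[OF assms, of "{}" b] by simp

section \<open>Lower tails of sums separated by gaps\<close>

text \<open>Exchange the joint law of past and future for the product law at cost \<open>\<beta>\<close>. Under the product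
  law, condition on the future value \<open>v\<close> and apply the tail bound of \<open>u\<close> at level \<open>s - v\<close>; the
  integral over \<open>v\<close> of \<open>exp (\<theta> * (s - v))\<close> yields the Laplace transform of \<open>v\<close>. The additive
  constant \<open>c\<close> passes through since a probability measure integrates it to itself.\<close>

lemma tail_add_after_gap_origin:
  fixes u v :: "(int \<Rightarrow> 'b::topological_space) \<Rightarrow> real"
  assumes P: "prob_space P" and Y: "\<And>i. Y i \<in> borel_measurable P"
    and u: "u \<in> borel_measurable path_space" "determined_on {..0} u"
    and v: "v \<in> borel_measurable path_space" "determined_on {int b..} v" "\<And>x. v x \<ge> 0"
    and "0 \<le> C" "0 \<le> c" "0 \<le> \<theta>"
    and tail: "\<And>r. measure P {\<omega>\<in>space P. u (\<lambda>i. Y i \<omega>) \<le> r} \<le> C * exp (\<theta> * r) + c"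
  shows "measure P {\<omega>\<in>space P. u (\<lambda>i. Y i \<omega>) + v (\<lambda>i. Y i \<omega>) \<le> s}
    \<le> C * exp (\<theta> * s) * (\<integral>\<omega>. exp (- \<theta> * v (\<lambda>i. Y i \<omega>)) \<partial>P) + c + beta_coeff P Y b"
proof -
  define M1 M2 where "M1 = (\<Pi>\<^sub>M i\<in>{..0::int}. borel :: 'b measure)"
    and "M2 = (\<Pi>\<^sub>M i\<in>{int b..}. borel :: 'b measure)"
  define L1 L2 where "L1 = law_on P Y {..0}" and "L2 = law_on P Y {int b..}"
  note sets_eq = sets_pair_measure_cong[of L1 M1 L2 M2]
  have [simp]: "sets L1 = sets M1" "sets L2 = sets M2" "space L1 = space M1" "space L2 = space M2"
    by (simp_all add: L1_def L2_def M1_def M2_def)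
  interpret P: prob_space P by (rule P)
  interpret L1: prob_space L1 unfolding L1_def by (rule prob_space_law_on[OF P Y])
  interpret L2: prob_space L2 unfolding L2_def by (rule prob_space_law_on[OF P Y])
  interpret L: pair_prob_space L1 L2 ..
  have m1 [measurable]: "(\<lambda>\<omega>. \<lambda>i\<in>{..0}. Y i \<omega>) \<in> measurable P M1"
    unfolding M1_def by (rule measurable_path[OF Y])
  have m2 [measurable]: "(\<lambda>\<omega>. \<lambda>i\<in>{int b..}. Y i \<omega>) \<in> measurable P M2"
    unfolding M2_def by (rule measurable_path[OF Y])
  have [measurable]: "u \<in> borel_measurable M1" "v \<in> borel_measurable M2"
    unfolding M1_def M2_def using u v by (auto intro: measurable_restricted_path_space)
  \<comment> \<open>The tail bound for \<open>u\<close> at the level left over by a future \<open>y\<close>.\<close>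
  define h where "h = (\<lambda>y. C * exp (\<theta> * (s - v y)) + c)"
  define A where "A = {z \<in> space (M1 \<Otimes>\<^sub>M M2). u (fst z) + v (snd z) \<le> s}"
  have A: "A \<in> sets (M1 \<Otimes>\<^sub>M M2)" unfolding A_def by measurable
  have u_eq: "u (\<lambda>i\<in>{..0}. Y i \<omega>) = u (\<lambda>i. Y i \<omega>)" for \<omega>
    using determined_onD[OF u(2)] .
  have v_eq: "v (\<lambda>i\<in>{int b..}. Y i \<omega>) = v (\<lambda>i. Y i \<omega>)" for \<omega>
    using determined_onD[OF v(2)] .
  have sp1: "(\<lambda>i\<in>{..0}. Y i \<omega>) \<in> space M1" if "\<omega> \<in> space P" for \<omega>
    using measurable_space[OF m1 that] .
  have sp2: "(\<lambda>i\<in>{int b..}. Y i \<omega>) \<in> space M2" if "\<omega> \<in> space P" for \<omega>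
    using measurable_space[OF m2 that] .
  have h_bound: "0 \<le> h y" "h y \<le> C * exp (\<theta> * s) + c" for y
    using assms(8,9,10) v(3)[of y] by (auto simp: h_def intro!: mult_left_mono)
  have h_meas [measurable]: "h \<in> borel_measurable M2"
    unfolding h_def by measurable
  have "measure P {\<omega>\<in>space P. u (\<lambda>i. Y i \<omega>) + v (\<lambda>i. Y i \<omega>) \<le> s}
      = measure (joint_law_on P Y {..0} {int b..}) A"
    unfolding joint_law_on_def M1_def[symmetric] M2_def[symmetric]
    by (subst measure_distr[OF _ A])
      (auto simp: A_def space_pair_measure u_eq v_eq sp1 sp2 intro!: arg_cong[where f="measure P"])
  also have "\<dots> \<le> measure (L1 \<Otimes>\<^sub>M L2) A + beta_coeff P Y b"
    using beta_coeff_upper[where Y=Y, OF P Y A[unfolded M1_def M2_def]] by (simp add: L1_def L2_def)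
  also have "measure (L1 \<Otimes>\<^sub>M L2) A \<le> (\<integral>y. h y \<partial>L2)"
  proof -
    have "emeasure (L1 \<Otimes>\<^sub>M L2) A = (\<integral>\<^sup>+y. emeasure L1 ((\<lambda>x. (x, y)) -` A) \<partial>L2)"
      by (rule L.emeasure_pair_measure_alt2) (simp add: sets_eq A)
    also have "\<dots> \<le> (\<integral>\<^sup>+y. ennreal (h y) \<partial>L2)"
    proof (rule nn_integral_mono)
      fix y assume y: "y \<in> space L2"
      have "(\<lambda>x. (x, y)) -` A = {x \<in> space M1. u x \<le> s - v y}"
        using y by (auto simp: A_def space_pair_measure)
      also have "measure L1 \<dots> = measure P {\<omega>\<in>space P. u (\<lambda>i. Y i \<omega>) \<le> s - v y}"
        unfolding L1_def law_on_def M1_def[symmetric]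
        by (subst measure_distr) (auto simp: u_eq sp1 intro!: arg_cong[where f="measure P"])
      also have "\<dots> \<le> h y" unfolding h_def by (rule tail)
      finally show "emeasure L1 ((\<lambda>x. (x, y)) -` A) \<le> ennreal (h y)"
        by (simp add: L1.emeasure_eq_measure ennreal_leI)
    qed
    also have "\<dots> = ennreal (\<integral>y. h y \<partial>L2)"
      using h_bound by (intro nn_integral_eq_integral L2.integrable_const_bound[where B="C * exp (\<theta> * s) + c"])
        (auto simp: measurable_cong_sets[of L2 M2 borel borel])
    finally show ?thesis
      using h_bound by (simp add: L.emeasure_eq_measure)
  qed
  also have "(\<integral>y. h y \<partial>L2) = (\<integral>\<omega>. h (\<lambda>i. Y i \<omega>) \<partial>P)"
    unfolding L2_def law_on_def M2_def[symmetric]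
    by (subst integral_distr[OF m2]) (auto simp: h_def v_eq)
  also have "\<dots> = (\<integral>\<omega>. C * exp (\<theta> * s) * exp (- \<theta> * v (\<lambda>i. Y i \<omega>)) + c \<partial>P)"
    by (simp add: h_def exp_add[symmetric] algebra_simps)
  also have "\<dots> = C * exp (\<theta> * s) * (\<integral>\<omega>. exp (- \<theta> * v (\<lambda>i. Y i \<omega>)) \<partial>P) + c"
  proof -
    have [measurable]: "(\<lambda>\<omega>. v (\<lambda>i. Y i \<omega>)) \<in> borel_measurable P"
      by (rule measurable_compose[OF measurable_full_path[OF Y] v(1)])
    have "integrable P (\<lambda>\<omega>. exp (- \<theta> * v (\<lambda>i. Y i \<omega>)))"
      using assms(10) v(3) by (intro P.integrable_const_bound[where B=1]) auto
    then show ?thesis by (simp add: P.prob_space)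
  qed
  finally show ?thesis by simp
qed

text \<open>The same at an arbitrary time \<open>k\<close>, by looking at the shifted process, which has the same mixing
  coefficients.\<close>

lemma tail_add_after_gap:
  fixes u v :: "(int \<Rightarrow> 'b::topological_space) \<Rightarrow> real"
  assumes P: "prob_space P" and Y: "\<And>i. Y i \<in> borel_measurable P" and st: "stationary P Y"
    and u: "u \<in> borel_measurable path_space" "determined_on {..k} u"
    and v: "v \<in> borel_measurable path_space" "determined_on {k + int b..} v" "\<And>x. v x \<ge> 0"
    and C: "0 \<le> C" "0 \<le> c" "0 \<le> \<theta>"
    and tail: "\<And>r. measure P {\<omega>\<in>space P. u (\<lambda>i. Y i \<omega>) \<le> r} \<le> C * exp (\<theta> * r) + c"
  shows "measure P {\<omega>\<in>space P. u (\<lambda>i. Y i \<omega>) + v (\<lambda>i. Y i \<omega>) \<le> s}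
    \<le> C * exp (\<theta> * s) * (\<integral>\<omega>. exp (- \<theta> * v (\<lambda>i. Y i \<omega>)) \<partial>P) + c + beta_coeff P Y b"
proof -
  \<comment> \<open>The functional that takes on the process shifted by \<open>k\<close> the value of \<open>w\<close> on \<open>Y\<close>.\<close>
  define delay where "delay = (\<lambda>(w :: (int \<Rightarrow> 'b) \<Rightarrow> real) x. w (\<lambda>i. x (i - k)))"
  have meas: "delay w \<in> borel_measurable path_space" if "w \<in> borel_measurable path_space" for w
    unfolding delay_def
  proof (rule measurable_compose[OF _ that])
    show "(\<lambda>x i. x (i - k)) \<in> measurable path_space (path_space :: (int \<Rightarrow> 'b) measure)"
      by (rule measurable_full_path) simp
  qed
  have det: "determined_on I (delay w)" if "determined_on J w" "\<And>i. i \<in> J \<longleftrightarrow> i - k \<in> I" for w I J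
    unfolding determined_on_def
  proof
    fix x :: "int \<Rightarrow> 'b"
    have "(\<lambda>i. restrict x I (i - k)) = restrict (\<lambda>i. x (i - k)) J"
      using that(2) by (simp add: restrict_def fun_eq_iff)
    then show "delay w (restrict x I) = delay w x"
      using determined_onD[OF that(1)] by (simp add: delay_def)
  qed
  have [simp]: "delay w (\<lambda>i. Y (i + k) \<omega>) = w (\<lambda>i. Y i \<omega>)" for w \<omega>
    by (simp add: delay_def)
  have "measure P {\<omega>\<in>space P. delay u (\<lambda>i. Y (i + k) \<omega>) + delay v (\<lambda>i. Y (i + k) \<omega>) \<le> s}
    \<le> C * exp (\<theta> * s) * (\<integral>\<omega>. exp (- \<theta> * delay v (\<lambda>i. Y (i + k) \<omega>)) \<partial>P) + c
      + beta_coeff P (\<lambda>i. Y (i + k)) b"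
  proof (rule tail_add_after_gap_origin[OF P])
    show "determined_on {..0} (delay u)" by (rule det[OF u(2)]) auto
    show "determined_on {int b..} (delay v)" by (rule det[OF v(2)]) auto
    show "0 \<le> delay v x" for x by (simp add: delay_def v(3))
  qed (simp_all add: Y meas u(1) v(1) C tail)
  then show ?thesis by (simp add: beta_coeff_shift[OF Y st])
qed

text \<open>The induction needs the bound at every level \<open>s\<close>. The empty sum satisfies it: it lies below \<open>s\<close>
  only if \<open>s \<ge> 0\<close>, where \<open>exp (\<theta> * s) \<ge> 1\<close>.\<close>

lemma lower_tail_sum_gaps:
  fixes v :: "nat \<Rightarrow> (int \<Rightarrow> 'b::topological_space) \<Rightarrow> real"
  assumes P: "prob_space P" and Y: "\<And>i. Y i \<in> borel_measurable P" and st: "stationary P Y"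
    and v: "\<And>l. v l \<in> borel_measurable path_space" "\<And>l. determined_on {lo l..hi l} (v l)"
      "\<And>l x. v l x \<ge> 0"
    and gap: "\<And>l m. l < m \<Longrightarrow> hi l + int b \<le> lo m"
    and \<theta>: "0 \<le> \<theta>"
    and L: "\<And>l. (\<integral>\<omega>. exp (- \<theta> * v l (\<lambda>i. Y i \<omega>)) \<partial>P) \<le> L"
  shows "measure P {\<omega>\<in>space P. (\<Sum>l<m. v l (\<lambda>i. Y i \<omega>)) \<le> s}
    \<le> L ^ m * exp (\<theta> * s) + real m * beta_coeff P Y b"
proof (induction m arbitrary: s)
  case 0
  interpret prob_space P by (rule P)
  show ?case using \<theta> by (cases "0 \<le> s") (auto simp: prob_space)
next
  case (Suc m)
  have "0 \<le> L"
    by (rule order_trans[OF _ L[of 0]]) simp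
  then have C: "0 \<le> L ^ m" by simp
  have "measure P {\<omega>\<in>space P. (\<Sum>l<m. v l (\<lambda>i. Y i \<omega>)) + v m (\<lambda>i. Y i \<omega>) \<le> s}
    \<le> L ^ m * exp (\<theta> * s) * (\<integral>\<omega>. exp (- \<theta> * v m (\<lambda>i. Y i \<omega>)) \<partial>P)
      + real m * beta_coeff P Y b + beta_coeff P Y b"
  proof (rule tail_add_after_gap[OF P Y st])
    show "determined_on {..lo m - int b} (\<lambda>x. \<Sum>l<m. v l x)"
      using gap by (intro determined_on_sum determined_on_mono[OF v(2)]) (fastforce simp: le_diff_eq)
    show "determined_on {lo m - int b + int b..} (v m)"
      by (intro determined_on_mono[OF v(2)]) auto
  qed (use v C \<theta> Suc beta_coeff_nonneg[OF P Y] in auto)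
  also have "\<dots> \<le> L ^ m * exp (\<theta> * s) * L + real m * beta_coeff P Y b + beta_coeff P Y b"
    using C L by (intro add_right_mono mult_left_mono) auto
  finally show ?case by (simp add: algebra_simps)
qed

section \<open>Lower deviations from second moments\<close>

lemma exp_minus_le_quadratic:
  fixes x :: real
  assumes "0 \<le> x"
  shows "exp (- x) \<le> 1 - x + x\<^sup>2 / 2"
proof -
  have "(1 - 0 + 0\<^sup>2 / 2) - exp (- 0) \<le> (1 - x + x\<^sup>2 / 2) - exp (- x)"
  proof (rule DERIV_nonneg_imp_nondecreasing[OF assms])
    fix y :: real
    have "((\<lambda>x. (1 - x + x\<^sup>2 / 2) - exp (- x)) has_real_derivative (y - 1 + exp (- y))) (at y)"
      by (auto intro!: derivative_eq_intros)
    moreover have "0 \<le> y - 1 + exp (- y)" using exp_ge_add_one_self[of "- y"] by simp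
    ultimately show "\<exists>D. ((\<lambda>x. (1 - x + x\<^sup>2 / 2) - exp (- x)) has_real_derivative D) (at y) \<and> 0 \<le> D"
      by blast
  qed
  then show ?thesis by simp
qed

text \<open>Nonnegativity replaces boundedness: it makes the quadratic bound on \<open>exp (- x)\<close> valid for all
  values of the variable, so that two moments control the Laplace transform.\<close>

lemma (in prob_space) laplace_transform_nonneg_bound:
  fixes Z :: "'a \<Rightarrow> real"
  assumes [measurable]: "Z \<in> borel_measurable M" and "\<And>\<omega>. 0 \<le> Z \<omega>"
    and "integrable M Z" "integrable M (\<lambda>\<omega>. (Z \<omega>)\<^sup>2)"
    and "expectation (\<lambda>\<omega>. (Z \<omega>)\<^sup>2) \<le> K" and "0 \<le> \<theta>"
  shows "expectation (\<lambda>\<omega>. exp (- \<theta> * Z \<omega>)) \<le> exp (- \<theta> * expectation Z + \<theta>\<^sup>2 * K / 2)"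
proof -
  have "expectation (\<lambda>\<omega>. exp (- \<theta> * Z \<omega>)) \<le> expectation (\<lambda>\<omega>. 1 - \<theta> * Z \<omega> + \<theta>\<^sup>2 / 2 * (Z \<omega>)\<^sup>2)"
  proof (rule integral_mono)
    show "integrable M (\<lambda>\<omega>. exp (- \<theta> * Z \<omega>))"
      using assms by (intro integrable_const_bound[where B=1]) auto
    show "exp (- \<theta> * Z \<omega>) \<le> 1 - \<theta> * Z \<omega> + \<theta>\<^sup>2 / 2 * (Z \<omega>)\<^sup>2" for \<omega>
      using exp_minus_le_quadratic[of "\<theta> * Z \<omega>"] assms by (simp add: power_mult_distrib)
  qed (use assms in auto)
  also have "\<dots> = 1 - \<theta> * expectation Z + \<theta>\<^sup>2 / 2 * expectation (\<lambda>\<omega>. (Z \<omega>)\<^sup>2)"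
    using assms by (simp add: prob_space)
  also have "\<dots> \<le> 1 + (- \<theta> * expectation Z + \<theta>\<^sup>2 * K / 2)"
    using mult_left_mono[OF assms(5), of "\<theta>\<^sup>2 / 2"] by simp
  also have "\<dots> \<le> exp (- \<theta> * expectation Z + \<theta>\<^sup>2 * K / 2)"
    by (rule exp_ge_add_one_self)
  finally show ?thesis .
qed


lemma integral_stationary:
  fixes g :: "(int \<Rightarrow> 'b::topological_space) \<Rightarrow> real"
  assumes Y: "\<And>i. Y i \<in> borel_measurable P" and st: "stationary P Y"
    and g: "g \<in> borel_measurable path_space"
  shows "(\<integral>\<omega>. g (\<lambda>i. Y (i + k) \<omega>) \<partial>P) = (\<integral>\<omega>. g (\<lambda>i. Y i \<omega>) \<partial>P)"
proof -
  have "(\<integral>\<omega>. g (\<lambda>i. Z i \<omega>) \<partial>P) = (\<integral>x. g x \<partial>distr P path_space (\<lambda>\<omega> i. Z i \<omega>))"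
    if "\<And>i. Z i \<in> borel_measurable P" for Z :: "int \<Rightarrow> 'a \<Rightarrow> 'b"
    by (rule integral_distr[OF measurable_full_path[OF that] g, symmetric])
  from this[of "\<lambda>i. Y (i + k)"] this[of Y] show ?thesis
    using Y st by (simp add: stationary_def)
qed

text \<open>Chernoff's method for the lower tail.\<close>

lemma mean_lower_deviation:
  fixes v :: "nat \<Rightarrow> (int \<Rightarrow> 'b::topological_space) \<Rightarrow> real"
  assumes P: "prob_space P" and Y: "\<And>i. Y i \<in> borel_measurable P" and st: "stationary P Y"
    and v: "\<And>l. v l \<in> borel_measurable path_space" "\<And>l. determined_on {lo l..hi l} (v l)"
      "\<And>l x. v l x \<ge> 0"
    and gap: "\<And>l m. l < m \<Longrightarrow> hi l + int b \<le> lo m"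
    and int: "\<And>l. integrable P (\<lambda>\<omega>. v l (\<lambda>i. Y i \<omega>))"
      "\<And>l. integrable P (\<lambda>\<omega>. (v l (\<lambda>i. Y i \<omega>))\<^sup>2)"
    and mean: "\<And>l. (\<integral>\<omega>. v l (\<lambda>i. Y i \<omega>) \<partial>P) = R"
    and second: "\<And>l. (\<integral>\<omega>. (v l (\<lambda>i. Y i \<omega>))\<^sup>2 \<partial>P) \<le> K"
    and "0 < K" "0 \<le> t"
  shows "measure P {\<omega>\<in>space P. (\<Sum>l<m. v l (\<lambda>i. Y i \<omega>)) \<le> real m * (R - t)}
    \<le> exp (- (real m * t\<^sup>2 / (2 * K))) + real m * beta_coeff P Y b"
proof -
  interpret prob_space P by (rule P)
  \<comment> \<open>This \<open>\<theta>\<close> minimizes the exponent \<open>\<theta>\<^sup>2 * K / 2 - \<theta> * t\<close>.\<close>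
  define \<theta> where "\<theta> = t / K"
  define L where "L = exp (- \<theta> * R + \<theta>\<^sup>2 * K / 2)"
  have \<theta>: "0 \<le> \<theta>" using assms(12,13) by (simp add: \<theta>_def)
  have "(\<integral>\<omega>. exp (- \<theta> * v l (\<lambda>i. Y i \<omega>)) \<partial>P) \<le> L" for l
    using laplace_transform_nonneg_bound[of "\<lambda>\<omega>. v l (\<lambda>i. Y i \<omega>)" K \<theta>]
      measurable_compose[OF measurable_full_path[OF Y] v(1)] v(3) int second \<theta>
    by (simp add: mean L_def)
  from lower_tail_sum_gaps[OF P Y st v gap \<theta> this]
  have "measure P {\<omega>\<in>space P. (\<Sum>l<m. v l (\<lambda>i. Y i \<omega>)) \<le> real m * (R - t)}
    \<le> L ^ m * exp (\<theta> * (real m * (R - t))) + real m * beta_coeff P Y b"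
    by simp
  also have "L ^ m * exp (\<theta> * (real m * (R - t)))
      = exp (real m * (- \<theta> * R + \<theta>\<^sup>2 * K / 2) + \<theta> * (real m * (R - t)))"
    by (simp add: L_def exp_of_nat_mult[symmetric] exp_add)
  also have "real m * (- \<theta> * R + \<theta>\<^sup>2 * K / 2) + \<theta> * (real m * (R - t)) = - (real m * t\<^sup>2 / (2 * K))"
    using assms(12) by (simp add: \<theta>_def field_simps power2_eq_square)
  finally show ?thesis .
qed

section \<open>Prediction losses and their blocks\<close>

text \<open>The time index \<open>t\<close> is that of the observation being predicted. It is an integer, whereas the
  index of \<^const>\<open>pred_loss\<close> is a natural number one less: integer times can be shifted freely.\<close>

definition loss_at :: "('b \<Rightarrow> real) \<Rightarrow> nat \<Rightarrow> ((nat \<Rightarrow> 'b) \<Rightarrow> 'b) \<Rightarrow> int \<Rightarrow> (int \<Rightarrow> 'b::ab_group_add) \<Rightarrow> real"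
  where "loss_at loss d f t x = loss (x t - f (\<lambda>j\<in>{..<d}. x (t - int d + int j)))"

text \<open>The training losses are those at the times \<open>d + 1 + i\<close> with \<open>i < 2 * \<mu> * a\<close>; block \<open>j\<close> averages
  those with \<open>i div a = j\<close>.\<close>

definition block_loss ::
  "('b \<Rightarrow> real) \<Rightarrow> nat \<Rightarrow> ((nat \<Rightarrow> 'b) \<Rightarrow> 'b) \<Rightarrow> nat \<Rightarrow> nat \<Rightarrow> (int \<Rightarrow> 'b::ab_group_add) \<Rightarrow> real" where
  "block_loss loss d f a j x =
     (\<Sum>i\<in>{j * a..<j * a + a}. loss_at loss d f (int (d + i) + 1) x) / real a"

lemma pred_loss_eq_loss_at: "pred_loss Y loss d f k \<omega> = loss_at loss d f (int k + 1) (\<lambda>i. Y i \<omega>)"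
  by (simp add: pred_loss_def loss_at_def window_def algebra_simps)

lemma determined_on_loss_at: "determined_on {t - int d..t} (loss_at loss d f t)"
proof -
  have "(\<lambda>j\<in>{..<d}. restrict x {t - int d..t} (t - int d + int j))
      = (\<lambda>j\<in>{..<d}. x (t - int d + int j))" for x :: "int \<Rightarrow> 'a"
    by (auto simp: restrict_def)
  then show ?thesis by (simp add: determined_on_def loss_at_def)
qed

text \<open>Block \<open>j\<close> reads \<open>a + d\<close> observations: its own \<open>a\<close> targets and the \<open>d\<close> observations before the
  first of them. The next block of the same parity starts \<open>2 * a\<close> later, so \<open>a - d\<close> observations
  lie between the two.\<close>

lemma determined_on_block_loss:
  "determined_on {int (j * a) + 1..int (d + j * a + a)} (block_loss loss d f a j)"
proof -
  have "determined_on {int (j * a) + 1..int (d + j * a + a)}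
    (\<lambda>x. \<Sum>i\<in>{j * a..<j * a + a}. loss_at loss d f (int (d + i) + 1) x)"
    by (intro determined_on_sum determined_on_mono[OF determined_on_loss_at]) (auto simp del: of_nat_mult)
  then show ?thesis
    by (simp add: determined_on_def block_loss_def)
qed

lemma measurable_loss_at:
  fixes loss :: "'b::{second_countable_topology, real_normed_vector} \<Rightarrow> real"
  assumes [measurable]: "loss \<in> borel_measurable borel" "f \<in> borel_measurable (window_space d)"
  shows "loss_at loss d f t \<in> borel_measurable path_space"
proof -
  have [measurable]: "(\<lambda>x. \<lambda>j\<in>{..<d}. x (t - int d + int j)) \<in> measurable path_space (window_space d :: (nat \<Rightarrow> 'b) measure)"
    by (rule measurable_restrict) simp
  show ?thesis unfolding loss_at_def[abs_def] by measurable
qed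

lemma measurable_block_loss:
  fixes loss :: "'b::{second_countable_topology, real_normed_vector} \<Rightarrow> real"
  assumes "loss \<in> borel_measurable borel" "f \<in> borel_measurable (window_space d)"
  shows "block_loss loss d f a j \<in> borel_measurable path_space"
  unfolding block_loss_def[abs_def]
  by (intro borel_measurable_divide borel_measurable_sum measurable_loss_at[OF assms]) simp

lemma risk_constant:
  fixes loss :: "'b::{second_countable_topology, real_normed_vector} \<Rightarrow> real"
  assumes "\<And>i. Y i \<in> borel_measurable P" "stationary P Y"
    and "loss \<in> borel_measurable borel" "f \<in> borel_measurable (window_space d)"
  shows "risk P Y loss d f k = risk P Y loss d f m"
proof -
  have "loss_at loss d f (int k + 1) x = loss_at loss d f (int m + 1) (\<lambda>i. x (i + (int k - int m)))" for x
    by (simp add: loss_at_def algebra_simps)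
  then show ?thesis
    using integral_stationary[OF assms(1,2) measurable_loss_at[OF assms(3,4)],
      of "int m + 1" "int k - int m"]
    by (simp add: risk_def pred_loss_eq_loss_at)
qed

text \<open>Two regroupings of the training sum: first into blocks, then the blocks into pairs of an even
  and an odd one.\<close>

lemma training_error_eq_block_losses:
  assumes "0 < a" "0 < \<mu>"
  shows "training_error Y loss d f (2 * \<mu> * a + d) \<omega> =
    ((\<Sum>l<\<mu>. block_loss loss d f a (2 * l) (\<lambda>i. Y i \<omega>))
      + (\<Sum>l<\<mu>. block_loss loss d f a (2 * l + 1) (\<lambda>i. Y i \<omega>))) / (2 * real \<mu>)"
proof -
  define g where "g = (\<lambda>i. loss_at loss d f (int (d + i) + 1) (\<lambda>i. Y i \<omega>))"
  have "(\<Sum>i = d+1..2 * \<mu> * a + d. pred_loss Y loss d f (i - 1) \<omega>) = (\<Sum>i<(2 * \<mu>) * a. g i)"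
    by (rule sum.reindex_bij_witness[where i="\<lambda>i. i + d + 1" and j="\<lambda>i. i - d - 1"])
      (auto simp: g_def pred_loss_eq_loss_at)
  also have "\<dots> = (\<Sum>j<\<mu> * 2. sum g {j * a..<j * a + a})"
    by (simp add: sum.nat_group mult.commute)
  also have "\<dots> = (\<Sum>l<\<mu>. \<Sum>j\<in>{l * 2..<l * 2 + 2}. sum g {j * a..<j * a + a})"
    by (rule sum.nat_group[symmetric])
  also have "\<dots> = (\<Sum>l<\<mu>. real a * (block_loss loss d f a (2 * l) (\<lambda>i. Y i \<omega>)
      + block_loss loss d f a (2 * l + 1) (\<lambda>i. Y i \<omega>)))"
  proof (rule sum.cong[OF refl])
    fix l :: nat
    have "{l * 2..<l * 2 + 2} = {2 * l, 2 * l + 1}" by auto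
    then show "(\<Sum>j\<in>{l * 2..<l * 2 + 2}. sum g {j * a..<j * a + a})
      = real a * (block_loss loss d f a (2 * l) (\<lambda>i. Y i \<omega>) + block_loss loss d f a (2 * l + 1) (\<lambda>i. Y i \<omega>))"
      using assms by (simp add: block_loss_def g_def distrib_left)
  qed
  also have "\<dots> = real a * ((\<Sum>l<\<mu>. block_loss loss d f a (2 * l) (\<lambda>i. Y i \<omega>))
      + (\<Sum>l<\<mu>. block_loss loss d f a (2 * l + 1) (\<lambda>i. Y i \<omega>)))"
    by (simp add: sum_distrib_left[symmetric] sum.distrib)
  finally show ?thesis
    using assms by (simp add: training_error_def)
qed

text \<open>The mean is that of a single loss by stationarity; the second moment bound survives averaging by
  convexity of the square.\<close>

lemma block_loss_moments:
  fixes loss :: "'b::{second_countable_topology, real_normed_vector} \<Rightarrow> real"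
  assumes P: "prob_space P" and Y: "\<And>i. Y i \<in> borel_measurable P" and st: "stationary P Y"
    and loss: "loss \<in> borel_measurable borel" and f: "f \<in> borel_measurable (window_space d)"
    and int: "\<And>k. k \<ge> d \<Longrightarrow> integrable P (\<lambda>\<omega>. (pred_loss Y loss d f k \<omega>)\<^sup>2)"
    and Q: "\<And>k. k \<ge> d \<Longrightarrow> Q_loss P Y loss d f k \<le> M"
    and "0 < a"
  shows "integrable P (\<lambda>\<omega>. block_loss loss d f a j (\<lambda>i. Y i \<omega>))"
    and "integrable P (\<lambda>\<omega>. (block_loss loss d f a j (\<lambda>i. Y i \<omega>))\<^sup>2)"
    and "(\<integral>\<omega>. block_loss loss d f a j (\<lambda>i. Y i \<omega>) \<partial>P) = risk P Y loss d f n"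
    and "(\<integral>\<omega>. (block_loss loss d f a j (\<lambda>i. Y i \<omega>))\<^sup>2 \<partial>P) \<le> M\<^sup>2"
proof -
  interpret prob_space P by (rule P)
  define J where "J = {j * a..<j * a + a}"
  define X where "X = (\<lambda>i. pred_loss Y loss d f (d + i))"
  have card: "card J = a" by (simp add: J_def)
  have W: "block_loss loss d f a j (\<lambda>i. Y i \<omega>) = (\<Sum>i\<in>J. X i \<omega>) / real a" for \<omega>
    by (simp add: block_loss_def J_def X_def pred_loss_eq_loss_at)
  have [measurable]: "X i \<in> borel_measurable P" for i
    unfolding X_def pred_loss_eq_loss_at[abs_def]
    by (rule measurable_compose[OF measurable_full_path[OF Y] measurable_loss_at[OF loss f]])
  have X2: "integrable P (\<lambda>\<omega>. (X i \<omega>)\<^sup>2)" for i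
    unfolding X_def by (rule int) simp
  have X1: "integrable P (X i)" for i
    by (rule square_integrable_imp_integrable[OF _ X2]) simp
  have X2_le: "(\<integral>\<omega>. (X i \<omega>)\<^sup>2 \<partial>P) \<le> M\<^sup>2" for i
    using Q[of "d + i"] unfolding Q_loss_def X_def by (intro sqrt_le_D) simp
  have X_mean: "(\<integral>\<omega>. X i \<omega> \<partial>P) = risk P Y loss d f n" for i
    using risk_constant[OF Y st loss f, of "d + i" n] by (simp add: risk_def X_def)
  have jensen: "((\<Sum>i\<in>J. X i \<omega>) / real a)\<^sup>2 \<le> (\<Sum>i\<in>J. (X i \<omega>)\<^sup>2) / real a" for \<omega>
    using sum_squared_le_sum_of_squares[of "\<lambda>i. X i \<omega>" J] assms(8)
    by (simp add: card power_divide field_simps power2_eq_square)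
  show "integrable P (\<lambda>\<omega>. block_loss loss d f a j (\<lambda>i. Y i \<omega>))"
    unfolding W using X1 by auto
  show sq: "integrable P (\<lambda>\<omega>. (block_loss loss d f a j (\<lambda>i. Y i \<omega>))\<^sup>2)"
    unfolding W
    by (rule Bochner_Integration.integrable_bound[where f="\<lambda>\<omega>. (\<Sum>i\<in>J. (X i \<omega>)\<^sup>2) / real a"])
      (use X2 jensen in \<open>auto simp: sum_nonneg\<close>)
  show "(\<integral>\<omega>. block_loss loss d f a j (\<lambda>i. Y i \<omega>) \<partial>P) = risk P Y loss d f n"
    unfolding W using X1 assms(8) by (simp add: X_mean card)
  have "(\<integral>\<omega>. (block_loss loss d f a j (\<lambda>i. Y i \<omega>))\<^sup>2 \<partial>P) \<le> (\<integral>\<omega>. (\<Sum>i\<in>J. (X i \<omega>)\<^sup>2) / real a \<partial>P)"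
    using sq jensen X2 unfolding W by (intro integral_mono) auto
  also have "\<dots> = (\<Sum>i\<in>J. \<integral>\<omega>. (X i \<omega>)\<^sup>2 \<partial>P) / real a"
    using X2 by simp
  also have "\<dots> \<le> (\<Sum>i\<in>J. M\<^sup>2) / real a"
    by (intro divide_right_mono sum_mono X2_le) simp
  also have "\<dots> = M\<^sup>2" using assms(8) by (simp add: card)
  finally show "(\<integral>\<omega>. (block_loss loss d f a j (\<lambda>i. Y i \<omega>))\<^sup>2 \<partial>P) \<le> M\<^sup>2" .
qed

section \<open>The deviation of the risk from the training error\<close>

text \<open>The training error is the mean of its even-block and odd-block averages, so a shortfall of \<open>t\<close> in
  the training error forces one in at least one of the two. This union bound is the origin of both
  factors \<open>2\<close>.\<close>

lemma risk_minus_training_error_tail: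
  fixes loss :: "'b::{second_countable_topology, real_normed_vector} \<Rightarrow> real"
  assumes P: "prob_space P" and Y: "\<And>i. Y i \<in> borel_measurable P" and st: "stationary P Y"
    and loss: "loss \<in> borel_measurable borel" "\<And>x. loss x \<ge> 0"
    and f: "f \<in> borel_measurable (window_space d)"
    and int: "\<And>k. k \<ge> d \<Longrightarrow> integrable P (\<lambda>\<omega>. (pred_loss Y loss d f k \<omega>)\<^sup>2)"
    and Q: "\<And>k. k \<ge> d \<Longrightarrow> Q_loss P Y loss d f k \<le> M"
    and "d < a" "0 < \<mu>" "0 < M" "0 \<le> t"
  shows "measure P {\<omega>\<in>space P. risk P Y loss d f n > training_error Y loss d f (2 * \<mu> * a + d) \<omega> + t}
    \<le> 2 * exp (- (real \<mu> * t\<^sup>2 / (2 * M\<^sup>2))) + 2 * real \<mu> * beta_coeff P Y (a - d)"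
proof -
  interpret prob_space P by (rule P)
  have a: "0 < a" using assms(9) by simp
  define W where "W = (\<lambda>j \<omega>. block_loss loss d f a j (\<lambda>i. Y i \<omega>))"
  define R where "R = risk P Y loss d f n"
  define B where "B = (\<lambda>r. {\<omega>\<in>space P. (\<Sum>l<\<mu>. W (2 * l + r) \<omega>) \<le> real \<mu> * (R - t)})"
  note moments = block_loss_moments[OF P Y st loss(1) f int Q a]
  have [measurable]: "W j \<in> borel_measurable P" for j
    unfolding W_def
    by (rule measurable_compose[OF measurable_full_path[OF Y] measurable_block_loss[OF loss(1) f]])
  have B_le: "prob (B r) \<le> exp (- (real \<mu> * t\<^sup>2 / (2 * M\<^sup>2))) + real \<mu> * beta_coeff P Y (a - d)" for r
    unfolding B_def W_def
  proof (rule mean_lower_deviation[OF P Y st, where K="M\<^sup>2" and R=R])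
    show "int (d + (2 * l + r) * a + a) + int (a - d) \<le> int ((2 * m + r) * a) + 1" if "l < m" for l m
    proof -
      have "int (d + (2 * l + r) * a + a) + int (a - d) = int ((2 * l + r + 2) * a)"
        using assms(9) by (simp add: of_nat_diff algebra_simps)
      also have "\<dots> \<le> int ((2 * m + r) * a)"
        using that by (intro of_nat_mono mult_right_mono) auto
      finally show ?thesis by simp
    qed
    show "determined_on {int ((2 * l + r) * a) + 1..int (d + (2 * l + r) * a + a)}
        (block_loss loss d f a (2 * l + r))" for l
      by (rule determined_on_block_loss)
    show "0 \<le> block_loss loss d f a (2 * l + r) x" for l x
      by (simp add: block_loss_def loss_at_def loss(2) sum_nonneg)
  qed (use moments measurable_block_loss[OF loss(1) f] assms(11,12) in \<open>auto simp: R_def\<close>)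
  have "{\<omega>\<in>space P. R > training_error Y loss d f (2 * \<mu> * a + d) \<omega> + t} \<subseteq> B 0 \<union> B 1"
  proof
    fix \<omega> assume "\<omega> \<in> {\<omega>\<in>space P. R > training_error Y loss d f (2 * \<mu> * a + d) \<omega> + t}"
    then have \<omega>: "\<omega> \<in> space P" and "training_error Y loss d f (2 * \<mu> * a + d) \<omega> < R - t" by auto
    then have "(\<Sum>l<\<mu>. W (2 * l) \<omega>) + (\<Sum>l<\<mu>. W (2 * l + 1) \<omega>) < 2 * (real \<mu> * (R - t))"
      using assms(10) unfolding training_error_eq_block_losses[OF a assms(10)] W_def
      by (simp add: field_simps)
    then have "(\<Sum>l<\<mu>. W (2 * l) \<omega>) \<le> real \<mu> * (R - t) \<or> (\<Sum>l<\<mu>. W (2 * l + 1) \<omega>) \<le> real \<mu> * (R - t)"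
      by linarith
    then show "\<omega> \<in> B 0 \<union> B 1" using \<omega> by (auto simp: B_def)
  qed
  then have "prob {\<omega>\<in>space P. R > training_error Y loss d f (2 * \<mu> * a + d) \<omega> + t} \<le> prob (B 0 \<union> B 1)"
    by (rule finite_measure_mono) (simp add: B_def)
  also have "\<dots> \<le> prob (B 0) + prob (B 1)"
    by (rule measure_Un_le) (simp_all add: B_def)
  finally show ?thesis using B_le[of 0] B_le[of 1] by (simp add: R_def)
qed

lemma risk_le_Q_loss:
  fixes loss :: "'b::{second_countable_topology, real_normed_vector} \<Rightarrow> real"
  assumes P: "prob_space P" and Y: "\<And>i. Y i \<in> borel_measurable P"
    and loss: "loss \<in> borel_measurable borel"
    and f: "f \<in> borel_measurable (window_space d)"
    and int: "integrable P (\<lambda>\<omega>. (pred_loss Y loss d f k \<omega>)\<^sup>2)"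
  shows "risk P Y loss d f k \<le> Q_loss P Y loss d f k"
proof -
  interpret prob_space P by (rule P)
  have [measurable]: "pred_loss Y loss d f k \<in> borel_measurable P"
    unfolding pred_loss_eq_loss_at[abs_def]
    by (rule measurable_compose[OF measurable_full_path[OF Y] measurable_loss_at[OF loss f]])
  have "integrable P (pred_loss Y loss d f k)"
    by (rule square_integrable_imp_integrable[OF _ int]) simp
  then have "0 \<le> expectation (\<lambda>\<omega>. (pred_loss Y loss d f k \<omega>)\<^sup>2) - (risk P Y loss d f k)\<^sup>2"
    using variance_eq[of "pred_loss Y loss d f k"] int variance_positive[of "pred_loss Y loss d f k"]
    by (simp add: risk_def)
  then show ?thesis
    unfolding Q_loss_def by (intro real_le_rsqrt) simp
qed

section \<open>The confidence radius\<close>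

text \<open>The quantity under the root vanishes as \<open>E\<close> approaches \<open>exp 4\<close>, so the first alternative, which
  makes the tail bound small enough, fails there. From \<open>ln x \<le> x - 1\<close> at \<open>x = E / exp 4\<close> one gets
  \<open>exp 4 - E \<le> exp 4 * (4 - ln E)\<close>: this is at least \<open>1\<close> for \<open>E \<le> exp 4 - 1\<close>, and for larger \<open>E\<close>
  the margin \<open>1 / 20\<close>, multiplied by \<open>E \<ge> 40\<close>, still gives the second alternative, a radius of at
  least the bound on the risk.\<close>

lemma radius_dichotomy:
  fixes E :: real
  assumes "0 < E" "E \<le> exp 4 - 1 / 20"
  shows "E \<le> exp 4 * (E * (4 - ln E)) \<or> 1 \<le> exp 4 * (E * (4 - ln E) / 2)"
proof -
  have "ln (E / exp 4) \<le> E / exp 4 - 1"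
    using assms(1) by (intro ln_le_minus_one) simp
  then have "1 - E / exp 4 \<le> 4 - ln E"
    using assms(1) by (simp add: ln_div)
  then have "exp 4 * (1 - E / exp 4) \<le> exp 4 * (4 - ln E)"
    by (intro mult_left_mono) auto
  then have "exp 4 - E \<le> exp 4 * (4 - ln E)"
    by (simp add: right_diff_distrib)
  then have *: "E * (exp 4 - E) \<le> exp 4 * (E * (4 - ln E))"
    using mult_left_mono[of "exp 4 - E" "exp 4 * (4 - ln E)" E] assms(1) by (simp add: mult.left_commute)
  show ?thesis
  proof (cases "E \<le> exp 4 - 1")
    case True
    then have "E * 1 \<le> E * (exp 4 - E)" using assms(1) by (intro mult_left_mono) auto
    with * show ?thesis by simp
  next
    case False
    \<comment> \<open>The estimate \<open>exp (1/2) \<ge> 1 + 1/2 + 1/8\<close>, raised to the eighth power.\<close>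
    have "(13/8 :: real) ^ 8 \<le> exp (1/2) ^ 8"
      using exp_lower_Taylor_quadratic[of "1/2"] by (intro power_mono) (auto simp: power2_eq_square)
    also have "exp (1/2) ^ 8 = (exp 4 :: real)" by (simp flip: exp_of_nat_mult)
    finally have "41 \<le> (exp 4 :: real)" by (simp add: power_divide)
    then have "40 * (1/20) \<le> E * (exp 4 - E)"
      using False assms by (intro mult_mono) auto
    with * show ?thesis by simp
  qed
qed

section \<open>The risk bound\<close>

theorem corollary13:
  fixes P :: "'w measure"
    and Y :: "int \<Rightarrow> 'w \<Rightarrow> real ^ 'p"
    and loss :: "real ^ 'p \<Rightarrow> real"
    and \<F> :: "((nat \<Rightarrow> real ^ 'p) \<Rightarrow> real ^ 'p) set"
    and f :: "(nat \<Rightarrow> real ^ 'p) \<Rightarrow> real ^ 'p"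
    and M \<eta> \<eta>' \<E> :: real
    and d n \<mu> a :: nat
  assumes "prob_space P"
    and "\<And>i. Y i \<in> borel_measurable P"
    and "stationary P Y"
    and "beta_mixing P Y"
    and "loss \<in> borel_measurable borel"
    and "\<And>x. loss x \<ge> 0"
    and "loss 0 = 0"
    and "d < n"
    and "\<And>g. g \<in> \<F> \<Longrightarrow> g \<in> borel_measurable (window_space d)"
    and "\<And>g k. g \<in> \<F> \<Longrightarrow> k \<ge> d \<Longrightarrow> integrable P (\<lambda>\<omega>. (pred_loss Y loss d g k \<omega>)\<^sup>2)"
    and "\<And>g k. g \<in> \<F> \<Longrightarrow> k \<ge> d \<Longrightarrow> Q_loss P Y loss d g k \<le> M"
    and "a > d"
    and "2 * \<mu> * a + d = n"
    and "f \<in> \<F>"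
    and "\<eta> > 2 * real \<mu> * beta_coeff P Y (a - d)"
    and "\<eta>' = \<eta> - 2 * real \<mu> * beta_coeff P Y (a - d)"
    and "\<E> = (4 * ln (real (growth_function (loss_universe d) n (loss_set loss d ` \<F>)))
               + 4 * ln (8 / \<eta>')) / real \<mu>"
    and "\<E> \<le> exp 4 - 1 / 20"
  shows "measure P {\<omega> \<in> space P.
           risk P Y loss d f n \<le> training_error Y loss d f n \<omega>
             + M * exp 2 * sqrt (\<E> * (4 - ln \<E>) / 2)} \<ge> 1 - \<eta>"
proof (cases "\<eta> \<ge> 1")
  case True
  then show ?thesis using measure_nonneg[of P] by (smt (verit))
next
  case False
  interpret prob_space P by (rule assms(1))
  note P = assms(1) and Y = assms(2) and st = assms(3) and loss = assms(5,6)
  note f = assms(9)[OF assms(14)] and int = assms(10)[OF assms(14)] and Q = assms(11)[OF assms(14)]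
  define R where "R = risk P Y loss d f n"
  define T where "T = training_error Y loss d f n"
  define X where "X = exp 4 * (\<E> * (4 - ln \<E>) / 2)"
  define t where "t = M * sqrt X"
  have "exp 2 * sqrt (\<E> * (4 - ln \<E>) / 2) = sqrt X"
  proof -
    have "exp 2 = sqrt (exp (4::real))"
      by (rule real_sqrt_unique[symmetric]) (simp_all flip: exp_of_nat_mult)
    then show ?thesis unfolding X_def by (simp only: real_sqrt_mult)
  qed
  then have t_eq: "M * exp 2 * sqrt (\<E> * (4 - ln \<E>) / 2) = t"
    by (simp add: t_def mult.assoc)
  have \<mu>: "0 < \<mu>" using assms(8,13) by (cases \<mu>) auto
  have \<beta>: "0 \<le> 2 * real \<mu> * beta_coeff P Y (a - d)"
    using beta_coeff_nonneg[OF P Y] by simp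
  then have \<eta>': "0 < \<eta>'" "\<eta>' < 1" using assms(15,16) False by linarith+
  have ln_pos: "0 < ln (8 / \<eta>')" using \<eta>' by (intro ln_gt_zero) simp
  \<comment> \<open>This covers \<open>G = 0\<close>, since \<open>ln 0 = 0\<close>.\<close>
  have "0 \<le> ln (real G)" for G :: nat by (cases "G = 0") auto
  then have \<mu>E: "4 * ln (8 / \<eta>') \<le> real \<mu> * \<E>"
    unfolding assms(17) using \<mu> by simp
  then have E: "0 < \<E>" using ln_pos \<mu> by (smt (verit) mult_nonneg_nonpos of_nat_0_le_iff)
  have R_le: "R \<le> M"
    using risk_le_Q_loss[OF P Y loss(1) f int, of n] Q[of n] assms(8) by (simp add: R_def)
  have T_nonneg: "0 \<le> T \<omega>" for \<omega>
    unfolding T_def training_error_def pred_loss_def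
    using assms(8) loss(2) by (intro mult_nonneg_nonneg sum_nonneg) auto
  have "0 \<le> Q_loss P Y loss d f d" by (simp add: Q_loss_def)
  then have M: "0 \<le> M" using Q[of d] by simp
  have X: "0 \<le> X" using radius_dichotomy[OF E assms(18)] E unfolding X_def by linarith
  then have t: "0 \<le> t" using M by (simp add: t_def)
  show ?thesis
  proof (cases "R \<le> t")
    \<comment> \<open>Includes the degenerate case \<open>M = 0\<close>, where the risk vanishes.\<close>
    case True
    then have "{\<omega> \<in> space P. R \<le> T \<omega> + t} = space P"
      using T_nonneg by (auto intro: add_increasing)
    moreover have "0 \<le> \<eta>" using assms(15) \<beta> by linarith
    ultimately show ?thesis unfolding t_eq by (simp add: R_def T_def prob_space)
  next
    case False
    then have less: "M * sqrt X < M * 1" using R_le by (simp add: t_def)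
    then have "0 < M" using M by (cases "M = 0") auto
    with less have "X < 1" by simp
    \<comment> \<open>As the radius is below \<open>M\<close>, the first alternative of the dichotomy holds.\<close>
    then have "\<E> \<le> 2 * X"
      using radius_dichotomy[OF E assms(18)] by (simp add: X_def)
    then have "real \<mu> * \<E> \<le> real \<mu> * (2 * X)" by (intro mult_left_mono) auto
    then have exponent: "ln (8 / \<eta>') \<le> real \<mu> * t\<^sup>2 / (2 * M\<^sup>2)"
      using \<mu>E \<open>0 < M\<close> X by (simp add: t_def power_mult_distrib)
    have "exp (- (real \<mu> * t\<^sup>2 / (2 * M\<^sup>2))) \<le> exp (- ln (8 / \<eta>'))" using exponent by simp
    also have "\<dots> = \<eta>' / 8" using \<eta>' by (simp add: exp_minus)
    finally have exp_le: "exp (- (real \<mu> * t\<^sup>2 / (2 * M\<^sup>2))) \<le> \<eta>' / 8" .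
    have [measurable]: "T \<in> borel_measurable P"
      unfolding T_def training_error_def[abs_def] pred_loss_eq_loss_at[abs_def]
      by (intro borel_measurable_times borel_measurable_sum borel_measurable_const
          measurable_compose[OF measurable_full_path[OF Y] measurable_loss_at[OF loss(1) f]])
    have "{\<omega> \<in> space P. R \<le> T \<omega> + t} = space P - {\<omega>\<in>space P. R > T \<omega> + t}" by auto
    then have "prob {\<omega> \<in> space P. R \<le> T \<omega> + t} = 1 - prob {\<omega>\<in>space P. R > T \<omega> + t}"
      by (simp add: prob_compl)
    moreover have "prob {\<omega>\<in>space P. R > T \<omega> + t}
        \<le> 2 * exp (- (real \<mu> * t\<^sup>2 / (2 * M\<^sup>2))) + 2 * real \<mu> * beta_coeff P Y (a - d)"
      using risk_minus_training_error_tail[OF P Y st loss f int Q assms(12) \<mu> \<open>0 < M\<close> t, of n]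
      by (simp add: R_def T_def assms(13))
    ultimately show ?thesis
      using exp_le \<eta>' unfolding t_eq by (simp add: R_def T_def assms(16))
  qed
qed

end
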